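(* Let $f$ be a holomorphic function on $\mathbb{D}=\{z\in\mathbb{C}:|z|<1\}$ with $|f|\le1$ and $f(0)=0$. Then, for $z\in\mathbb{D}\setminus\{0\}$, $$\left|f'(z)(1-|f'(0)|^2)-\frac{2f(z)}{z}+\overline{f'(0)}\cdot\left(\frac{f(z)}{z}\right)^2+f'(0)\right|\le\frac{1}{1-|z|^2}\left(\left|z-\overline{f'(0)}f(z)\right|^2-\left|\frac{f(z)}{z}-f'(0)\right|^2\right).$$ In particular, if $f'(0)=0$ in addition, then $$\left|f'(z)-\frac{2f(z)}{z}\right|\le\frac{|z|^4-|f(z)|^2}{|z|^2(1-|z|^2)}.$$ *)

theory Defs
  imports "HOL-Complex_Analysis.Complex_Analysis"
begin

end

theory Submission
  imports Defs
begin

text \<open>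
  Write \<open>f z = z * g z\<close> and \<open>a = deriv f 0 = g 0\<close>. The function \<open>g\<close> maps the disc into the closed
  disc, hence so does the Schur quotient \<open>k\<close> of \<open>g\<close>, which satisfies
  \<open>g z - a = k z * (z - cnj a * f z)\<close>. Differentiating this relation shows that the left-hand side
  of the claim is the norm of \<open>deriv k z * (z - cnj a * f z)\<^sup>2\<close>, so the claim is the
  Schwarz-Pick inequality for \<open>k\<close>, multiplied by \<open>(cmod (z - cnj a * f z))\<^sup>2\<close>.

  The relation is kept in multiplied-out form. Then nothing is ever divided by
  \<open>z - cnj a * f z\<close>, which vanishes identically when \<open>f\<close> is a rotation, and the equality case
  needs no separate treatment.

  Everything rests on one tool, the Schur step (\<open>schur_quotient_exists\<close>). Applied to \<open>f\<close> it
  gives \<open>g\<close>, applied to \<open>g\<close> it gives \<open>k\<close>, and applied to \<open>k\<close> composed with a disc automorphism it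
  gives the Schwarz-Pick inequality (\<open>schwarz_pick_deriv\<close>).
\<close>

text \<open>
  The Schwarz lemma, applied to \<open>g\<close> followed by the disc automorphism that sends \<open>g 0\<close> to \<open>0\<close>.
  By the maximum principle a non-constant \<open>g\<close> maps into the open disc, where that
  automorphism is defined; for a constant \<open>g\<close>, possibly unimodular, \<open>k = 0\<close> serves.
\<close>

lemma schur_quotient_exists:
  assumes holg: "g holomorphic_on ball 0 1"
    and le1: "\<And>z. z \<in> ball 0 1 \<Longrightarrow> cmod (g z) \<le> 1"
  obtains k where "k holomorphic_on ball 0 1"
    and "\<And>z. z \<in> ball 0 1 \<Longrightarrow> cmod (k z) \<le> 1"
    and "\<And>z. z \<in> ball 0 1 \<Longrightarrow> g z - g 0 = z * k z * (1 - cnj (g 0) * g z)"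
proof (cases "g constant_on ball 0 1")
  case True
  then obtain c where "\<And>z. z \<in> ball 0 1 \<Longrightarrow> g z = c"
    unfolding constant_on_def by blast
  then show thesis
    using that[of "\<lambda>_. 0"] by simp
next
  case False
  have lt1: "cmod (g z) < 1" if z: "z \<in> ball 0 1" for z
  proof (rule ccontr)
    assume "\<not> cmod (g z) < 1"
    then have "\<And>w. w \<in> ball 0 1 \<Longrightarrow> cmod (g w) \<le> cmod (g z)"
      using le1 by fastforce
    then have "g constant_on ball 0 1"
      using maximum_modulus_principle[OF holg open_ball connected_ball open_ball order_refl z] by blast
    then show False
      using False by blast
  qed
  define h where "h = (\<lambda>z. Moebius_function 0 (g 0) (g z))"
  have g0: "cmod (g 0) < 1"
    using lt1 by simp
  have holh: "h holomorphic_on ball 0 1"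
    unfolding h_def
    using holomorphic_on_compose_gen[OF holg Moebius_function_holomorphic[OF g0, of 0]] lt1
    by (force simp: o_def)
  have h0: "h 0 = 0"
    by (simp add: h_def Moebius_function_eq_zero)
  have hlt1: "cmod (h z) < 1" if "cmod z < 1" for z
    unfolding h_def using g0 lt1 that by (simp add: Moebius_function_norm_lt_1)
  obtain k where holk: "k holomorphic_on ball 0 1"
    and hk: "\<And>z. cmod z < 1 \<Longrightarrow> h z = z * k z" and dh: "deriv h 0 = k 0"
    using Schwarz3[OF holh h0] by blast
  show thesis
  proof (rule that[OF holk])
    fix z :: complex
    assume z: "z \<in> ball 0 1"
    show "cmod (k z) \<le> 1"
    proof (cases "z = 0")
      case True
      then show ?thesis
        using Schwarz_Lemma(2)[OF holh h0 hlt1, of 0] dh by simp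
    next
      case False
      then show ?thesis
        using Schwarz_Lemma(1)[OF holh h0 hlt1, of z] hk z by (simp add: norm_mult)
    qed
    have "cmod (cnj (g 0) * g z) < 1"
      using g0 lt1[OF z] norm_mult_less[of "cnj (g 0)" 1 "g z" 1] by simp
    then have "1 - cnj (g 0) * g z \<noteq> 0"
      by auto
    then have "g z - g 0 = h z * (1 - cnj (g 0) * g z)"
      by (simp add: h_def Moebius_function_simple)
    then show "g z - g 0 = z * k z * (1 - cnj (g 0) * g z)"
      using hk z by simp
  qed
qed

text \<open>
  At the origin this follows by differentiating the relation of the Schur step. A general point
  \<open>w\<close> is moved to the origin by the automorphism \<open>Moebius_function 0 (- w)\<close>, whose derivative at
  \<open>0\<close> is \<open>1 - (cmod w)\<^sup>2\<close>.
\<close>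

lemma schwarz_pick_deriv:
  assumes holk: "k holomorphic_on ball 0 1"
    and le1: "\<And>z. z \<in> ball 0 1 \<Longrightarrow> cmod (k z) \<le> 1"
    and w: "w \<in> ball 0 1"
  shows "cmod (deriv k w) * (1 - (cmod w)\<^sup>2) \<le> 1 - (cmod (k w))\<^sup>2"
proof -
  define M where "M = Moebius_function 0 (- w)"
  define G where "G = (\<lambda>z. k (M z))"
  have w1: "cmod (- w) < 1"
    using w by simp
  have M0: "M 0 = w"
    by (simp add: M_def Moebius_function_of_zero)
  have Mball: "M z \<in> ball 0 1" if "z \<in> ball 0 1" for z
    using that w1 Moebius_function_norm_lt_1[of "- w" z 0] by (simp add: M_def)
  have holG: "G holomorphic_on ball 0 1"
    unfolding G_def
    using holomorphic_on_compose_gen[OF Moebius_function_holomorphic[OF w1, of 0] holk] Mball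
    by (force simp: o_def M_def)
  have dM: "(M has_field_derivative (1 - w * cnj w)) (at 0)"
    unfolding M_def Moebius_function_def
    by (auto intro!: derivative_eq_intros simp: algebra_simps)
  have dk: "(k has_field_derivative deriv k w) (at (M 0))"
    using holomorphic_derivI[OF holk open_ball w] by (simp add: M0)
  have dG: "(G has_field_derivative deriv k w * (1 - w * cnj w)) (at 0)"
    unfolding G_def using DERIV_chain2[OF dk dM] .
  obtain K where holK: "K holomorphic_on ball 0 1"
    and K1: "\<And>z. z \<in> ball 0 1 \<Longrightarrow> cmod (K z) \<le> 1"
    and K: "\<And>z. z \<in> ball 0 1 \<Longrightarrow> G z - G 0 = z * K z * (1 - cnj (G 0) * G z)"
    using schur_quotient_exists[OF holG] le1 Mball unfolding G_def by metis
  have dK: "(K has_field_derivative deriv K 0) (at 0)"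
    using holomorphic_derivI[OF holK open_ball] by simp
  have "((\<lambda>z. z * K z * (1 - cnj (G 0) * G z)) has_field_derivative
          K 0 * (1 - cnj (G 0) * G 0)) (at 0)"
    by (auto intro!: derivative_eq_intros dG dK)
  then have "((\<lambda>z. G z - G 0) has_field_derivative K 0 * (1 - cnj (G 0) * G 0)) (at 0)"
    by (rule has_field_derivative_transform_within_open[of _ _ _ "ball 0 1"]) (simp_all add: K)
  moreover have "((\<lambda>z. G z - G 0) has_field_derivative deriv k w * (1 - w * cnj w)) (at 0)"
    by (auto intro!: derivative_eq_intros dG)
  ultimately have "deriv k w * (1 - w * cnj w) = K 0 * (1 - cnj (G 0) * G 0)"
    using DERIV_unique by blast
  moreover have "1 - w * cnj w = complex_of_real (1 - (cmod w)\<^sup>2)"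
    by (simp only: of_real_diff of_real_1 complex_norm_square)
  moreover have "1 - cnj (G 0) * G 0 = complex_of_real (1 - (cmod (k w))\<^sup>2)"
    by (simp only: of_real_diff of_real_1 complex_norm_square G_def M0 mult.commute)
  ultimately have eq: "deriv k w * complex_of_real (1 - (cmod w)\<^sup>2)
      = K 0 * complex_of_real (1 - (cmod (k w))\<^sup>2)"
    by simp
  have pos: "0 \<le> 1 - (cmod w)\<^sup>2" "0 \<le> 1 - (cmod (k w))\<^sup>2"
    using w le1[OF w] by (simp_all add: power_le_one)
  have "cmod (deriv k w) * (1 - (cmod w)\<^sup>2) = cmod (K 0) * (1 - (cmod (k w))\<^sup>2)"
    using arg_cong[OF eq, of cmod] pos unfolding norm_mult norm_of_real by simp
  also have "\<dots> \<le> 1 - (cmod (k w))\<^sup>2"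
    using mult_right_mono[OF K1[of 0] pos(2)] by simp
  finally show ?thesis .
qed

lemma second_order_schwarz_pick:
  assumes holf: "f holomorphic_on ball 0 1"
    and le1: "\<And>z. z \<in> ball 0 1 \<Longrightarrow> cmod (f z) \<le> 1"
    and f0: "f 0 = 0"
    and z: "z \<in> ball 0 1" "z \<noteq> 0"
  shows "cmod (deriv f z * (1 - complex_of_real ((cmod (deriv f 0))\<^sup>2)) - 2 * f z / z
            + cnj (deriv f 0) * (f z / z)\<^sup>2 + deriv f 0)
        \<le> 1 / (1 - (cmod z)\<^sup>2) *
            ((cmod (z - cnj (deriv f 0) * f z))\<^sup>2 - (cmod (f z / z - deriv f 0))\<^sup>2)"
proof -
  define a where "a = deriv f 0"
  define D where "D = z - cnj a * f z"
  obtain g where holg: "g holomorphic_on ball 0 1"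
    and g1: "\<And>u. u \<in> ball 0 1 \<Longrightarrow> cmod (g u) \<le> 1"
    and fg: "\<And>u. u \<in> ball 0 1 \<Longrightarrow> f u = u * g u"
    using schur_quotient_exists[OF holf le1] f0 by auto
  have dg: "(g has_field_derivative deriv g u) (at u)" if "u \<in> ball 0 1" for u
    using holomorphic_derivI[OF holg open_ball that] .
  have df: "(f has_field_derivative g u + u * deriv g u) (at u)" if u: "u \<in> ball 0 1" for u
  proof -
    have "((\<lambda>u. u * g u) has_field_derivative g u + u * deriv g u) (at u)"
      by (auto intro!: derivative_eq_intros dg u)
    then show ?thesis
      by (rule has_field_derivative_transform_within_open[of _ _ _ "ball 0 1"])
        (use u fg in auto)
  qed
  have dfz: "deriv f z = g z + z * deriv g z"
    using DERIV_imp_deriv[OF df[OF z(1)]] .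
  have g0: "g 0 = a"
    using DERIV_imp_deriv[OF df[of 0]] by (simp add: a_def)
  obtain k where holk: "k holomorphic_on ball 0 1"
    and k1: "\<And>u. u \<in> ball 0 1 \<Longrightarrow> cmod (k u) \<le> 1"
    and gk: "\<And>u. u \<in> ball 0 1 \<Longrightarrow> g u - a = u * k u * (1 - cnj a * g u)"
    using schur_quotient_exists[OF holg g1] g0 by metis
  have gkf: "g u - a = k u * (u - cnj a * f u)" if "u \<in> ball 0 1" for u
    unfolding gk[OF that] fg[OF that] by (simp add: algebra_simps)
  have dk: "(k has_field_derivative deriv k z) (at z)"
    using holomorphic_derivI[OF holk open_ball z(1)] .
  have "((\<lambda>u. k u * (u - cnj a * f u)) has_field_derivative
          deriv k z * D + k z * (1 - cnj a * deriv f z)) (at z)"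
    unfolding D_def dfz
    by (auto intro!: derivative_eq_intros dk df z)
  then have "((\<lambda>u. g u - a) has_field_derivative
          deriv k z * D + k z * (1 - cnj a * deriv f z)) (at z)"
    by (rule has_field_derivative_transform_within_open[of _ _ _ "ball 0 1"])
      (use z gkf in auto)
  moreover have "((\<lambda>u. g u - a) has_field_derivative deriv g z) (at z)"
    by (auto intro!: derivative_eq_intros dg z)
  ultimately have dgk: "deriv g z = deriv k z * D + k z * (1 - cnj a * deriv f z)"
    using DERIV_unique by blast
  have gz: "f z / z = g z"
    using fg[OF z(1)] z(2) by simp
  have gD: "g z - a = k z * D"
    using gkf[OF z(1)] by (simp add: D_def)
  have Dg: "D = z * (1 - cnj a * g z)"
    using fg[OF z(1)] by (simp add: D_def algebra_simps)

  \<comment> \<open>The right-hand side is the numerator that the quotient rule gives for \<open>(g u - a) / (u - cnj a * f u)\<close>.\<close>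
  have "deriv f z * (1 - complex_of_real ((cmod a)\<^sup>2)) - 2 * f z / z + cnj a * (f z / z)\<^sup>2 + a
      = deriv g z * D - (g z - a) * (1 - cnj a * deriv f z)"
    unfolding times_divide_eq_right[symmetric] gz Dg dfz complex_norm_square
    by (simp add: algebra_simps power2_eq_square)
  also have "\<dots> = deriv k z * D\<^sup>2"
    unfolding gD dgk by (simp add: algebra_simps power2_eq_square)
  finally have lhs: "cmod (deriv f z * (1 - complex_of_real ((cmod a)\<^sup>2)) - 2 * f z / z
      + cnj a * (f z / z)\<^sup>2 + a) = cmod (deriv k z) * (cmod D)\<^sup>2"
    by (simp only: norm_mult norm_power)
  have pos: "0 < 1 - (cmod z)\<^sup>2"
    using z by (simp add: power_less_one_iff)
  have "cmod (deriv k z) * (1 - (cmod z)\<^sup>2) * (cmod D)\<^sup>2 \<le> (1 - (cmod (k z))\<^sup>2) * (cmod D)\<^sup>2"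
    using schwarz_pick_deriv[OF holk k1 z(1)] by (intro mult_right_mono) auto
  also have "\<dots> = (cmod D)\<^sup>2 - (cmod (g z - a))\<^sup>2"
    by (simp add: gD norm_mult power_mult_distrib left_diff_distrib)
  finally have "cmod (deriv k z) * (cmod D)\<^sup>2
      \<le> 1 / (1 - (cmod z)\<^sup>2) * ((cmod D)\<^sup>2 - (cmod (g z - a))\<^sup>2)"
    using pos by (simp add: pos_le_divide_eq ac_simps)
  then show ?thesis
    unfolding a_def[symmetric] lhs by (simp only: D_def gz)
qed

theorem theorem3p8:
  fixes f :: "complex \<Rightarrow> complex"
  assumes "f holomorphic_on ball 0 1"
    and "\<forall>z\<in>ball 0 1. cmod (f z) \<le> 1"
    and "f 0 = 0"
  shows "(\<forall>z\<in>ball 0 1 - {0}.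
            cmod (deriv f z * (1 - complex_of_real ((cmod (deriv f 0))\<^sup>2)) - 2 * f z / z
                  + cnj (deriv f 0) * (f z / z)\<^sup>2 + deriv f 0)
            \<le> 1 / (1 - (cmod z)\<^sup>2) *
                ((cmod (z - cnj (deriv f 0) * f z))\<^sup>2 - (cmod (f z / z - deriv f 0))\<^sup>2))
       \<and> (deriv f 0 = 0 \<longrightarrow>
            (\<forall>z\<in>ball 0 1 - {0}.
               cmod (deriv f z - 2 * f z / z)
               \<le> ((cmod z) ^ 4 - (cmod (f z))\<^sup>2) / ((cmod z)\<^sup>2 * (1 - (cmod z)\<^sup>2))))"
proof (intro conjI impI ballI)
  fix z :: complex
  assume "z \<in> ball 0 1 - {0}"
  then have z: "z \<in> ball 0 1" "z \<noteq> 0"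
    by auto
  have *: "cmod (deriv f z * (1 - complex_of_real ((cmod (deriv f 0))\<^sup>2)) - 2 * f z / z
            + cnj (deriv f 0) * (f z / z)\<^sup>2 + deriv f 0)
        \<le> 1 / (1 - (cmod z)\<^sup>2) *
            ((cmod (z - cnj (deriv f 0) * f z))\<^sup>2 - (cmod (f z / z - deriv f 0))\<^sup>2)"
    using second_order_schwarz_pick[OF assms(1) _ assms(3) z] assms(2) by blast
  then show "cmod (deriv f z * (1 - complex_of_real ((cmod (deriv f 0))\<^sup>2)) - 2 * f z / z
            + cnj (deriv f 0) * (f z / z)\<^sup>2 + deriv f 0)
        \<le> 1 / (1 - (cmod z)\<^sup>2) *
            ((cmod (z - cnj (deriv f 0) * f z))\<^sup>2 - (cmod (f z / z - deriv f 0))\<^sup>2)" .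
  assume "deriv f 0 = 0"
  then have "cmod (deriv f z - 2 * f z / z)
      \<le> 1 / (1 - (cmod z)\<^sup>2) * ((cmod z)\<^sup>2 - (cmod (f z))\<^sup>2 / (cmod z)\<^sup>2)"
    using * by (simp add: norm_divide power_divide)
  also have "(cmod z)\<^sup>2 - (cmod (f z))\<^sup>2 / (cmod z)\<^sup>2
      = ((cmod z) ^ 4 - (cmod (f z))\<^sup>2) / (cmod z)\<^sup>2"
    using z(2) by (simp add: diff_divide_distrib power4_eq_xxxx power2_eq_square)
  finally show "cmod (deriv f z - 2 * f z / z)
      \<le> ((cmod z) ^ 4 - (cmod (f z))\<^sup>2) / ((cmod z)\<^sup>2 * (1 - (cmod z)\<^sup>2))"
    by (simp add: mult.commute)
qed

end
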